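(* Let $G$ be a finite group. Then $G$ is autonilpotent if and only if $G$ is the direct product of its Sylow subgroups and, for every $p\in\pi(G)$, the automorphism group of a Sylow $p$-subgroup of $G$ is a $p$-group.
   Context: All groups are finite. $\pi(G)$ is the set of prime divisors of $|G|$. $\mathrm{Aut}\,G$ is the group of all automorphisms of $G$. For $x\in G$ and $\alpha\in\mathrm{Aut}\,G$, $x^\alpha$ denotes the image of $x$ under $\alpha$, $[x,\alpha]=x^{-1}x^\alpha$, and inductively $[x,\alpha_1,\dots,\alpha_n]=[[x,\alpha_1,\dots,\alpha_{n-1}],\alpha_n]$. For a natural number $n$ let $L_n(G)=\{x\in G \mid [x,\alpha_1,\dots,\alpha_n]=1 \text{ for all } \alpha_1,\dots,\alpha_n\in\mathrm{Aut}\,G\}$. The group $G$ is called autonilpotent if $G=L_n(G)$ for some natural number $n$. *)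

theory Defs
  imports "HOL-Algebra.Algebra"
begin

definition autocommutator :: "('a, 'b) monoid_scheme \<Rightarrow> 'a \<Rightarrow> ('a \<Rightarrow> 'a) \<Rightarrow> 'a"
  where "autocommutator G x \<alpha> = inv\<^bsub>G\<^esub> x \<otimes>\<^bsub>G\<^esub> \<alpha> x"

text \<open>The list \<open>[\<alpha>\<^sub>1, \<dots>, \<alpha>\<^sub>n]\<close> yields the left-normed \<open>[x, \<alpha>\<^sub>1, \<dots>, \<alpha>\<^sub>n]\<close>; the empty list yields \<open>x\<close>.\<close>
definition iterated_autocommutator :: "('a, 'b) monoid_scheme \<Rightarrow> 'a \<Rightarrow> ('a \<Rightarrow> 'a) list \<Rightarrow> 'a"
  where "iterated_autocommutator G x \<alpha>s = foldl (autocommutator G) x \<alpha>s"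

definition autocentre :: "('a, 'b) monoid_scheme \<Rightarrow> nat \<Rightarrow> 'a set"
  where "autocentre G n =
    {x \<in> carrier G. \<forall>\<alpha>s. length \<alpha>s = n \<and> set \<alpha>s \<subseteq> auto G \<longrightarrow>
      iterated_autocommutator G x \<alpha>s = \<one>\<^bsub>G\<^esub>}"

definition autonilpotent :: "('a, 'b) monoid_scheme \<Rightarrow> bool"
  where "autonilpotent G \<longleftrightarrow> (\<exists>n\<ge>1. carrier G = autocentre G n)"

definition sylow_subgroups :: "('a, 'b) monoid_scheme \<Rightarrow> nat \<Rightarrow> 'a set set"
  where "sylow_subgroups G p = {P. subgroup P G \<and> card P = p ^ multiplicity p (order G)}"

text \<open>\<open>\<H>\<close> is a set rather than an indexed family: no subgroup occurs twice as a factor.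
  For \<open>\<H> = {}\<close> this says that \<open>G\<close> is trivial.\<close>
definition internal_direct_product :: "('a, 'b) monoid_scheme \<Rightarrow> 'a set set \<Rightarrow> bool"
  where "internal_direct_product G \<H> \<longleftrightarrow>
    (\<forall>H\<in>\<H>. H \<lhd> G) \<and>
    generate G (\<Union>\<H>) = carrier G \<and>
    (\<forall>H\<in>\<H>. H \<inter> generate G (\<Union>(\<H> - {H})) = {\<one>\<^bsub>G\<^esub>})"

text \<open>For \<open>p > 0\<close> the right-hand side forces the carrier to be finite, since \<open>order\<close> is \<open>0\<close> on infinite groups.\<close>
definition is_p_group :: "nat \<Rightarrow> ('a, 'b) monoid_scheme \<Rightarrow> bool"
  where "is_p_group p G \<longleftrightarrow> group G \<and> (\<exists>k. order G = p ^ k)"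

end

theory Submission
  imports Defs
begin

text \<open>
  Write \<open>L\<^sub>n\<close> for \<open>autocentre G n\<close>. An element \<open>x\<close> lies in \<open>L\<^sub>n\<^sub>+\<^sub>1\<close> iff every automorphism moves \<open>x\<close> only
  within its coset \<open>x L\<^sub>n\<close>, so the \<open>L\<^sub>n\<close> form an ascending chain of characteristic subgroups
  whose factors are fixed pointwise by the full automorphism group. As inner automorphisms are
  among the automorphisms, this chain is also a central series.

  Suppose first that all Sylow subgroups are normal and have automorphism groups of prime power
  order. For a \<open>p\<close>-group \<open>P\<close> whose automorphism group is a \<open>p\<close>-group, \<open>Aut P\<close> permutes the cosets
  of \<open>L\<^sub>n(P)\<close>, a set of \<open>p\<close>-power size in which \<open>L\<^sub>n(P)\<close> itself is a fixed point. If \<open>L\<^sub>n(P)\<close> is proper,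
  counting orbits modulo \<open>p\<close> gives a second fixed coset, and its elements belong to
  \<open>L\<^sub>n\<^sub>+\<^sub>1(P)\<close>; hence the chain climbs to \<open>P\<close> (\<open>autocentre_psubset_Suc\<close>, \<open>p_group_autonilpotent\<close>).
  A normal Sylow subgroup is invariant under every automorphism of \<open>G\<close>, so \<open>L\<^sub>n(P)\<close> is contained
  in \<open>L\<^sub>n(G)\<close>. For large \<open>n\<close> the subgroup \<open>L\<^sub>n(G)\<close> therefore contains all Sylow subgroups, which
  together generate \<open>G\<close>.

  Conversely, let \<open>G\<close> be autonilpotent. If \<open>x\<close> and \<open>y\<close> have coprime orders, their commutator \<open>c\<close> sinks
  down the central series: if \<open>c\<close> is central modulo \<open>L\<^sub>i\<close>, then its order modulo \<open>L\<^sub>i\<close> divides both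
  orders, so \<open>c\<close> is in \<open>L\<^sub>i\<close>. Thus \<open>x\<close> and \<open>y\<close> commute (\<open>autonilpotent_coprime_commute\<close>). The normaliser
  of a Sylow subgroup then contains a Sylow subgroup for every prime, so it is all of \<open>G\<close>. With
  normality, a Sylow \<open>p\<close>-subgroup \<open>P\<close> is complemented by the subgroup generated by the other Sylow
  subgroups, whose elements have order prime to \<open>p\<close> (\<open>autonilpotent_sylow_complement\<close>). So each automorphism of \<open>P\<close>
  extends to \<open>G\<close> by the identity on the complement, and \<open>P\<close> inherits autonilpotency. Finally, an
  automorphism that acts trivially on the factors of a chain of length \<open>n\<close> in a group of order \<open>p\<^sup>a\<close>
  has order dividing \<open>p\<^sup>a\<^sup>n\<close> (\<open>autonilpotent_auto_exponent\<close>), and Cauchy's theorem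
  turns this into the statement that \<open>Aut P\<close> is a \<open>p\<close>-group.
\<close>

section \<open>Automorphisms of a group\<close>

context group
begin

lemma auto_group_hom: "\<alpha> \<in> auto G \<Longrightarrow> group_hom G G \<alpha>"
  by (auto simp: auto_def group_hom_def group_hom_axioms_def)

lemma auto_closed: "\<alpha> \<in> auto G \<Longrightarrow> x \<in> carrier G \<Longrightarrow> \<alpha> x \<in> carrier G"
  by (auto simp: auto_def hom_def)

lemma auto_mult: "\<alpha> \<in> auto G \<Longrightarrow> x \<in> carrier G \<Longrightarrow> y \<in> carrier G \<Longrightarrow> \<alpha> (x \<otimes> y) = \<alpha> x \<otimes> \<alpha> y"
  by (auto simp: auto_def hom_def)

lemma auto_one: "\<alpha> \<in> auto G \<Longrightarrow> \<alpha> \<one> = \<one>"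
  using auto_group_hom group_hom.hom_one by blast

lemma auto_inv: "\<alpha> \<in> auto G \<Longrightarrow> x \<in> carrier G \<Longrightarrow> \<alpha> (inv x) = inv (\<alpha> x)"
  using auto_group_hom group_hom.hom_inv by fastforce

lemma auto_compose:
  assumes "\<alpha> \<in> auto G" "\<beta> \<in> auto G"
  shows "compose (carrier G) \<alpha> \<beta> \<in> auto G"
  using subgroup.m_closed[OF subgroup_auto assms] assms by (simp add: BijGroup_def auto_def)

lemma auto_inverse:
  assumes "\<alpha> \<in> auto G"
  obtains \<beta> where "\<beta> \<in> auto G" "\<And>x. x \<in> carrier G \<Longrightarrow> \<alpha> (\<beta> x) = x" "\<And>x. x \<in> carrier G \<Longrightarrow> \<beta> (\<alpha> x) = x"
proof
  have bij: "bij_betw \<alpha> (carrier G) (carrier G)" and B: "\<alpha> \<in> Bij (carrier G)"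
    using assms by (auto simp: auto_def Bij_def)
  show "restrict (inv_into (carrier G) \<alpha>) (carrier G) \<in> auto G"
    using subgroup.m_inv_closed[OF subgroup_auto assms] by (simp add: inv_BijGroup B)
  show "\<alpha> (restrict (inv_into (carrier G) \<alpha>) (carrier G) x) = x" if "x \<in> carrier G" for x
    using bij that by (simp add: bij_betw_inv_into_right)
  show "restrict (inv_into (carrier G) \<alpha>) (carrier G) (\<alpha> x) = x" if "x \<in> carrier G" for x
    using bij that assms by (simp add: bij_betw_inv_into_left auto_closed)
qed

lemma conjugation_in_auto:
  assumes g: "g \<in> carrier G"
  shows "(\<lambda>x\<in>carrier G. g \<otimes> x \<otimes> inv g) \<in> auto G"
proof -
  have "(\<lambda>x\<in>carrier G. g \<otimes> x \<otimes> inv g) \<in> hom G G"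
  proof (rule homI)
    fix x y assume "x \<in> carrier G" "y \<in> carrier G"
    then show "(\<lambda>x\<in>carrier G. g \<otimes> x \<otimes> inv g) (x \<otimes> y) =
        (\<lambda>x\<in>carrier G. g \<otimes> x \<otimes> inv g) x \<otimes> (\<lambda>x\<in>carrier G. g \<otimes> x \<otimes> inv g) y"
      using g by (simp add: m_assoc inv_solve_left)
  qed (use g in auto)
  then show ?thesis
    using conjugation_is_bij[OF g] by (simp add: auto_def Bij_def)
qed

section \<open>The autocentral series\<close>

lemma mult_inv_cancel_left: "x \<in> carrier G \<Longrightarrow> y \<in> carrier G \<Longrightarrow> x \<otimes> (inv x \<otimes> y) = y"
  by (simp add: m_assoc[symmetric])

lemma autocommutator_closed [simp]:
  "\<alpha> \<in> auto G \<Longrightarrow> x \<in> carrier G \<Longrightarrow> autocommutator G x \<alpha> \<in> carrier G"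
  by (simp add: autocommutator_def auto_closed)

lemma mult_autocommutator:
  "\<alpha> \<in> auto G \<Longrightarrow> x \<in> carrier G \<Longrightarrow> x \<otimes> autocommutator G x \<alpha> = \<alpha> x"
  by (simp add: autocommutator_def auto_closed m_assoc[symmetric])

lemma autocentre_0: "autocentre G 0 = {\<one>}"
  by (auto simp: autocentre_def iterated_autocommutator_def)

text \<open>Peeling off the first automorphism of the list turns the definition into the recursion of an
  upper central series, which is the form used everywhere below.\<close>
lemma autocentre_Suc:
  "autocentre G (Suc n) = {x \<in> carrier G. \<forall>\<alpha>\<in>auto G. autocommutator G x \<alpha> \<in> autocentre G n}"
    (is "?L = ?R")
proof (intro equalityI subsetI)
  fix x assume x: "x \<in> ?L"
  then have xc: "x \<in> carrier G" by (simp add: autocentre_def)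
  have "iterated_autocommutator G (autocommutator G x \<alpha>) \<alpha>s = \<one>"
    if "\<alpha> \<in> auto G" "length \<alpha>s = n" "set \<alpha>s \<subseteq> auto G" for \<alpha> \<alpha>s
    using x that by (auto simp: autocentre_def iterated_autocommutator_def dest!: spec[of _ "\<alpha> # \<alpha>s"])
  with xc show "x \<in> ?R" by (auto simp: autocentre_def)
next
  fix x assume x: "x \<in> ?R"
  then show "x \<in> ?L"
    by (auto simp: autocentre_def iterated_autocommutator_def length_Suc_conv)
qed

lemma autocentre_mono:
  assumes "m \<le> n"
  shows "autocentre G m \<subseteq> autocentre G n"
proof -
  have "autocentre G n \<subseteq> autocentre G (Suc n)" for n
  proof (induction n)
    case 0
    show ?case by (auto simp: autocentre_0 autocentre_Suc autocommutator_def auto_one)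
  next
    case (Suc n)
    then show ?case by (subst (1 2) autocentre_Suc) auto
  qed
  then show ?thesis using assms by (rule lift_Suc_mono_le)
qed

text \<open>Both claims go through one induction: closure of the next term under products and
  inverses uses that conjugation preserves the current term, which is an instance of invariance;
  and invariance of the next term uses \<open>[x\<^sup>\<beta>, \<alpha>] = [x, \<beta>\<alpha>\<beta>\<inverse>]\<^sup>\<beta>\<close>, with maps applied on the right.\<close>
lemma autocentre_characteristic:
  shows autocentre_subgroup: "subgroup (autocentre G n) G"
    and autocentre_invariant: "\<alpha> \<in> auto G \<Longrightarrow> x \<in> autocentre G n \<Longrightarrow> \<alpha> x \<in> autocentre G n"
proof -
  have "subgroup (autocentre G n) G \<and> (\<forall>\<alpha>\<in>auto G. \<forall>x\<in>autocentre G n. \<alpha> x \<in> autocentre G n)"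
  proof (induction n)
    case 0
    show ?case by (simp add: autocentre_0 triv_subgroup auto_one)
  next
    case (Suc n)
    let ?N = "autocentre G n"
    interpret N: subgroup ?N G using Suc by blast
    have inv: "\<alpha> x \<in> ?N" if "\<alpha> \<in> auto G" "x \<in> ?N" for \<alpha> x
      using Suc that by blast
    have conj: "g \<otimes> x \<otimes> inv g \<in> ?N" if "g \<in> carrier G" "x \<in> ?N" for g x
      using inv[OF conjugation_in_auto[OF that(1)] that(2)] that by auto
    have "subgroup (autocentre G (Suc n)) G"
    proof (rule subgroupI)
      show "autocentre G (Suc n) \<subseteq> carrier G" by (auto simp: autocentre_Suc)
      have "\<one> \<in> autocentre G (Suc n)" by (simp add: autocentre_Suc autocommutator_def auto_one)
      then show "autocentre G (Suc n) \<noteq> {}" by blast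
    next
      fix x assume "x \<in> autocentre G (Suc n)"
      then have x: "x \<in> carrier G" and xN: "autocommutator G x \<alpha> \<in> ?N" if "\<alpha> \<in> auto G" for \<alpha>
        using that by (auto simp: autocentre_Suc)
      have "autocommutator G (inv x) \<alpha> \<in> ?N" if a: "\<alpha> \<in> auto G" for \<alpha>
      proof -
        have "autocommutator G (inv x) \<alpha> = x \<otimes> inv (autocommutator G x \<alpha>) \<otimes> inv x"
          using a x[OF a] by (simp add: autocommutator_def auto_inv auto_closed inv_mult_group m_assoc)
        then show ?thesis using conj x[OF a] xN[OF a] by simp
      qed
      then show "inv x \<in> autocentre G (Suc n)"
        using \<open>x \<in> autocentre G (Suc n)\<close> by (simp add: autocentre_Suc)
    next
      fix x y assume xy: "x \<in> autocentre G (Suc n)" "y \<in> autocentre G (Suc n)"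
      then have x: "x \<in> carrier G" and y: "y \<in> carrier G" by (auto simp: autocentre_Suc)
      have "autocommutator G (x \<otimes> y) \<alpha> \<in> ?N" if a: "\<alpha> \<in> auto G" for \<alpha>
      proof -
        have "autocommutator G (x \<otimes> y) \<alpha> =
            (inv y \<otimes> autocommutator G x \<alpha> \<otimes> inv (inv y)) \<otimes> autocommutator G y \<alpha>"
          using a x y by (simp add: autocommutator_def auto_mult auto_closed inv_mult_group m_assoc mult_inv_cancel_left)
        moreover have "inv y \<otimes> autocommutator G x \<alpha> \<otimes> inv (inv y) \<in> ?N"
          using conj[of "inv y"] y xy(1) a by (simp add: autocentre_Suc)
        ultimately show ?thesis using xy(2) a by (simp add: autocentre_Suc)
      qed
      then show "x \<otimes> y \<in> autocentre G (Suc n)" using x y by (simp add: autocentre_Suc)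
    qed
    moreover have "\<beta> x \<in> autocentre G (Suc n)"
      if b: "\<beta> \<in> auto G" and "x \<in> autocentre G (Suc n)" for \<beta> x
    proof -
      have x: "x \<in> carrier G" using that by (simp add: autocentre_Suc)
      obtain \<gamma> where c: "\<gamma> \<in> auto G" "\<And>x. x \<in> carrier G \<Longrightarrow> \<beta> (\<gamma> x) = x"
        using auto_inverse[OF b] by metis
      have "autocommutator G (\<beta> x) \<alpha> \<in> ?N" if a: "\<alpha> \<in> auto G" for \<alpha>
      proof -
        \<comment> \<open>\<open>?\<delta>\<close> is the conjugate \<open>\<beta>\<inverse> \<circ> \<alpha> \<circ> \<beta>\<close>.\<close>
        let ?\<delta> = "compose (carrier G) \<gamma> (compose (carrier G) \<alpha> \<beta>)"
        have d: "?\<delta> \<in> auto G" using a b c by (simp add: auto_compose)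
        have "autocommutator G (\<beta> x) \<alpha> = \<beta> (autocommutator G x ?\<delta>)"
          using a b c x by (simp add: autocommutator_def auto_mult auto_inv auto_closed compose_def)
        then show ?thesis using inv[OF b] d \<open>x \<in> autocentre G (Suc n)\<close> by (simp add: autocentre_Suc)
      qed
      then show ?thesis using b x by (simp add: autocentre_Suc auto_closed)
    qed
    ultimately show ?case by blast
  qed
  then show "subgroup (autocentre G n) G"
    and "\<alpha> \<in> auto G \<Longrightarrow> x \<in> autocentre G n \<Longrightarrow> \<alpha> x \<in> autocentre G n" by blast+
qed

lemma autocentre_normal: "autocentre G n \<lhd> G"
  unfolding normal_inv_iff
proof (intro conjI ballI)
  fix g x assume "g \<in> carrier G" "x \<in> autocentre G n"
  then show "g \<otimes> x \<otimes> inv g \<in> autocentre G n"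
    using autocentre_invariant[OF conjugation_in_auto[of g], of x n]
      subgroup.mem_carrier[OF autocentre_subgroup, of x n] by simp
qed (rule autocentre_subgroup)

lemma autonilpotentI:
  assumes "carrier G \<subseteq> autocentre G n"
  shows "autonilpotent G"
  unfolding autonilpotent_def
  \<comment> \<open>\<open>Suc n\<close> meets the requirement of a positive index, which matters for the trivial group.\<close>
  using assms autocentre_mono[of n "Suc n"] subgroup.subset[OF autocentre_subgroup]
  by (intro exI[of _ "Suc n"]) auto

section \<open>Elements of coprime order commute\<close>

lemma pow_eq_one_coprime:
  assumes "x \<in> carrier G" "x [^] (k::nat) = \<one>" "x [^] (m::nat) = \<one>" "coprime k m"
  shows "x = \<one>"
proof -
  have "ord x dvd k" "ord x dvd m" using assms pow_eq_id by auto
  then have "ord x = 1" using coprime_common_divisor[OF assms(4)] by auto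
  then show ?thesis using assms(1) ord_eq_1 by simp
qed

lemma pow_card_subgroup:
  assumes "subgroup H G" "x \<in> H"
  shows "x [^] card H = \<one>"
proof -
  interpret H: group "G\<lparr>carrier := H\<rparr>" using assms(1) by (rule subgroup_imp_group)
  show ?thesis using H.pow_order_eq_1[of x] assms(2) by (simp add: order_def nat_pow_consistent[symmetric])
qed

lemma card_subgroup_dvd: "subgroup H G \<Longrightarrow> card H dvd order G"
  by (metis lagrange dvd_triv_right)

text \<open>A central commutator \<open>c\<close> of \<open>x\<close> and \<open>y\<close> is bilinear in powers: moving \<open>y\<close> past \<open>x\<^sup>i\<close>, or \<open>y\<^sup>i\<close> past \<open>x\<close>,
  produces \<open>c\<^sup>i\<close>. So the order of \<open>c\<close> divides both exponents.\<close>
lemma central_commutator_coprime: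
  assumes x: "x \<in> carrier G" and y: "y \<in> carrier G" and c: "c \<in> carrier G"
    and yx: "y \<otimes> x = x \<otimes> c \<otimes> y"
    and central: "\<And>g. g \<in> carrier G \<Longrightarrow> c \<otimes> g = g \<otimes> c"
    and "x [^] (k::nat) = \<one>" "y [^] (m::nat) = \<one>" "coprime k m"
  shows "c = \<one>"
proof -
  have 1: "y \<otimes> x [^] i = x [^] i \<otimes> c [^] i \<otimes> y" for i :: nat
  proof (induction i)
    case 0 show ?case using y by simp
  next
    case (Suc i)
    have "y \<otimes> x [^] Suc i = (y \<otimes> x [^] i) \<otimes> x" using x y by (simp add: m_assoc)
    also have "\<dots> = x [^] i \<otimes> c [^] i \<otimes> (y \<otimes> x)" using x y c Suc by (simp add: m_assoc)
    also have "\<dots> = x [^] i \<otimes> (c [^] i \<otimes> x) \<otimes> c \<otimes> y" using x y c by (simp add: yx m_assoc)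
    also have "c [^] i \<otimes> x = x \<otimes> c [^] i" using group_commutes_pow[OF central c] x c by simp
    finally show ?case using x y c by (simp add: m_assoc)
  qed
  have 2: "y [^] i \<otimes> x = x \<otimes> c [^] i \<otimes> y [^] i" for i :: nat
  proof (induction i)
    case 0 show ?case using x by simp
  next
    case (Suc i)
    have "y [^] Suc i \<otimes> x = y [^] i \<otimes> (y \<otimes> x)" using x y by (simp add: m_assoc)
    also have "\<dots> = (y [^] i \<otimes> x) \<otimes> c \<otimes> y" using x y c by (simp add: yx m_assoc)
    also have "\<dots> = x \<otimes> c [^] i \<otimes> (y [^] i \<otimes> c) \<otimes> y" using x y c by (simp add: Suc m_assoc)
    also have "y [^] i \<otimes> c = c \<otimes> y [^] i" using central y by simp
    finally show ?case using x y c by (simp add: m_assoc)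
  qed
  have "y = c [^] k \<otimes> y" using 1[of k] assms by simp
  then have ck: "c [^] k = \<one>" using y c right_cancel[of y "c [^] k" \<one>] by simp
  have "x = x \<otimes> c [^] m" using 2[of m] assms by simp
  then have "c [^] m = \<one>" using x c Units_l_cancel[of x "c [^] m" \<one>] by simp
  then show ?thesis using pow_eq_one_coprime c ck assms(8) by blast
qed

text \<open>The commutator \<open>c\<close> of \<open>x\<close> and \<open>y\<close> lies in some term of the series, and each term is
  central modulo the one below it; applying \<open>central_commutator_coprime\<close> in the quotients pushes \<open>c\<close>
  down to the trivial term.\<close>
lemma autonilpotent_coprime_commute:
  assumes nil: "autonilpotent G" and x: "x \<in> carrier G" and y: "y \<in> carrier G"
    and xk: "x [^] (k::nat) = \<one>" and ym: "y [^] (m::nat) = \<one>" and "coprime k m"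
  shows "x \<otimes> y = y \<otimes> x"
proof -
  let ?conj = "\<lambda>g. \<lambda>x\<in>carrier G. g \<otimes> x \<otimes> inv g"
  define c where "c = autocommutator G x (?conj y)"
  have c: "c \<in> carrier G" using conjugation_in_auto[OF y] x by (simp add: c_def)
  have yx: "y \<otimes> x = x \<otimes> c \<otimes> y"
    using x y mult_autocommutator[OF conjugation_in_auto[OF y] x]
    by (simp add: c_def m_assoc)
  have step: "c \<in> autocentre G i" if ci: "c \<in> autocentre G (Suc i)" for i
  proof -
    interpret N: normal "autocentre G i" G by (rule autocentre_normal)
    let ?N = "autocentre G i" and ?Q = "G Mod autocentre G i"
    interpret Q: group ?Q by (rule N.factorgroup_is_group)
    have "?N #> c = \<one>\<^bsub>?Q\<^esub>"
    proof (rule Q.central_commutator_coprime[of "?N #> x" "?N #> y"])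
      show "?N #> x \<in> carrier ?Q" "?N #> y \<in> carrier ?Q" "?N #> c \<in> carrier ?Q"
        using x y c by (auto simp: carrier_FactGroup)
      show "(?N #> y) \<otimes>\<^bsub>?Q\<^esub> (?N #> x) = (?N #> x) \<otimes>\<^bsub>?Q\<^esub> (?N #> c) \<otimes>\<^bsub>?Q\<^esub> (?N #> y)"
        using x y c by (simp add: N.rcos_sum yx)
      show "(?N #> x) [^]\<^bsub>?Q\<^esub> k = \<one>\<^bsub>?Q\<^esub>" "(?N #> y) [^]\<^bsub>?Q\<^esub> m = \<one>\<^bsub>?Q\<^esub>"
        using x y by (simp_all add: N.FactGroup_pow xk ym N.subset)
      fix g assume "g \<in> carrier ?Q"
      then obtain h where h: "h \<in> carrier G" and g: "g = ?N #> h" by (auto simp: carrier_FactGroup)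
      have "autocommutator G c (?conj h) \<in> ?N"
        using ci conjugation_in_auto[OF h] by (simp add: autocentre_Suc)
      then have "c \<otimes> autocommutator G c (?conj h) \<otimes> inv c \<in> ?N"
        using c N.inv_op_closed2 by simp
      \<comment> \<open>With \<open>h c h\<inverse> = c [c, h]\<close> this conjugate is \<open>h c h\<inverse> c\<inverse>\<close>, so \<open>c\<close> is central modulo \<open>?N\<close>.\<close>
      then have "(h \<otimes> c) \<otimes> inv (c \<otimes> h) \<in> ?N"
        using mult_autocommutator[OF conjugation_in_auto[OF h] c] c h
        by (simp add: m_assoc inv_mult_group)
      then have "?N #> (c \<otimes> h) = ?N #> (h \<otimes> c)"
        using N.rcos_module_rev[OF is_group, of "c \<otimes> h" "h \<otimes> c"] c h
        by (intro repr_independence) (auto simp: autocentre_subgroup)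
      then show "(?N #> c) \<otimes>\<^bsub>?Q\<^esub> g = g \<otimes>\<^bsub>?Q\<^esub> (?N #> c)"
        using c h g by (simp add: N.rcos_sum)
    qed fact
    then show ?thesis using c coset_join1[OF _ _ autocentre_subgroup] by simp
  qed
  obtain n where "carrier G = autocentre G n" using nil by (auto simp: autonilpotent_def)
  then have "c \<in> autocentre G n" using c by simp
  then have "c \<in> autocentre G 0" by (induction n) (use step in auto)
  then have "c = \<one>" by (simp add: autocentre_0)
  then show ?thesis using yx x y by simp
qed

section \<open>Automorphism groups of autonilpotent groups\<close>

lemma AutoGroup_simps:
  "carrier (AutoGroup G) = auto G"
  "\<one>\<^bsub>AutoGroup G\<^esub> = (\<lambda>x\<in>carrier G. x)"
  "\<alpha> \<in> auto G \<Longrightarrow> \<beta> \<in> auto G \<Longrightarrow> \<alpha> \<otimes>\<^bsub>AutoGroup G\<^esub> \<beta> = compose (carrier G) \<alpha> \<beta>"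
  by (auto simp: AutoGroup_def BijGroup_def auto_def)

lemma AutoGroup_pow_in_auto: "\<alpha> \<in> auto G \<Longrightarrow> \<alpha> [^]\<^bsub>AutoGroup G\<^esub> (n::nat) \<in> auto G"
  using monoid.nat_pow_closed[OF group.is_monoid[OF AutoGroup], of \<alpha> n] by (simp add: AutoGroup_simps)

lemma AutoGroup_pow_Suc_apply:
  assumes "\<alpha> \<in> auto G" "x \<in> carrier G"
  shows "(\<alpha> [^]\<^bsub>AutoGroup G\<^esub> Suc n) x = (\<alpha> [^]\<^bsub>AutoGroup G\<^esub> n) (\<alpha> x)"
  using assms AutoGroup_pow_in_auto[OF assms(1)] by (simp add: AutoGroup_simps compose_def)

lemma finite_auto:
  assumes "finite (carrier G)"
  shows "finite (auto G)"
proof (rule finite_subset)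
  show "auto G \<subseteq> carrier G \<rightarrow>\<^sub>E carrier G"
    by (auto simp: auto_def hom_def Bij_def PiE_def)
qed (simp add: finite_PiE assms)

text \<open>An automorphism \<open>\<beta>\<close> that fixes \<open>L\<^sub>k\<close> pointwise sends \<open>x \<in> L\<^sub>k\<^sub>+\<^sub>1\<close> to \<open>x c\<close> with \<open>c \<in> L\<^sub>k\<close>, hence \<open>\<beta>\<^sup>j\<close>
  sends \<open>x\<close> to \<open>x c\<^sup>j\<close>. So each step up the series costs one further factor of the group order.\<close>
lemma auto_pow_fixes_autocentre:
  assumes a: "\<alpha> \<in> auto G" and x: "x \<in> autocentre G k"
  shows "(\<alpha> [^]\<^bsub>AutoGroup G\<^esub> (order G ^ k)) x = x"
  using x
proof (induction k arbitrary: x)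
  case 0
  then have "x = \<one>" by (simp add: autocentre_0)
  then show ?case using auto_one[OF AutoGroup_pow_in_auto[OF a]] by metis
next
  case (Suc k)
  interpret A: group "AutoGroup G" by (rule AutoGroup)
  define \<beta> where "\<beta> = \<alpha> [^]\<^bsub>AutoGroup G\<^esub> (order G ^ k)"
  define c where "c = autocommutator G x \<beta>"
  have b: "\<beta> \<in> auto G" using AutoGroup_pow_in_auto[OF a] by (simp add: \<beta>_def)
  have x: "x \<in> carrier G" and cN: "c \<in> autocentre G k"
    using Suc.prems b by (auto simp: autocentre_Suc c_def)
  have c: "c \<in> carrier G" using x b by (simp add: c_def)
  have bx: "\<beta> x = x \<otimes> c" using mult_autocommutator[OF b x] by (simp add: c_def)
  have bc: "\<beta> c = c" using Suc.IH[OF cN] by (simp add: \<beta>_def)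
  have pc: "(\<beta> [^]\<^bsub>AutoGroup G\<^esub> j) c = c" for j :: nat
  proof (induction j)
    case 0 show ?case using c by (simp add: AutoGroup_simps)
  next
    case (Suc j) then show ?case using AutoGroup_pow_Suc_apply[OF b c] by (simp add: bc)
  qed
  have px: "(\<beta> [^]\<^bsub>AutoGroup G\<^esub> j) x = x \<otimes> c [^] j" for j :: nat
  proof (induction j)
    case 0 show ?case using x by (simp add: AutoGroup_simps)
  next
    case (Suc j)
    have "(\<beta> [^]\<^bsub>AutoGroup G\<^esub> Suc j) x = (\<beta> [^]\<^bsub>AutoGroup G\<^esub> j) (x \<otimes> c)"
      using AutoGroup_pow_Suc_apply[OF b x] by (simp add: bx)
    also have "\<dots> = x \<otimes> c [^] j \<otimes> c"
      using auto_mult[OF AutoGroup_pow_in_auto[OF b] x c] by (simp add: Suc pc)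
    finally show ?case using x c by (simp add: m_assoc)
  qed
  have "\<alpha> [^]\<^bsub>AutoGroup G\<^esub> (order G ^ Suc k) = \<beta> [^]\<^bsub>AutoGroup G\<^esub> order G"
    using a by (simp add: \<beta>_def A.nat_pow_pow AutoGroup_simps mult.commute)
  then show ?case using px[of "order G"] x c by (simp add: pow_order_eq_1)
qed

lemma autonilpotent_auto_exponent:
  assumes "carrier G = autocentre G n" "\<alpha> \<in> auto G"
  shows "\<alpha> [^]\<^bsub>AutoGroup G\<^esub> (order G ^ n) = \<one>\<^bsub>AutoGroup G\<^esub>"
proof
  fix x
  have e: "\<alpha> [^]\<^bsub>AutoGroup G\<^esub> (order G ^ n) \<in> extensional (carrier G)"
    using AutoGroup_pow_in_auto[OF assms(2)] by (auto simp: auto_def Bij_def)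
  show "(\<alpha> [^]\<^bsub>AutoGroup G\<^esub> (order G ^ n)) x = \<one>\<^bsub>AutoGroup G\<^esub> x"
    using auto_pow_fixes_autocentre[OF assms(2), of x n] assms(1) extensional_arb[OF e, of x]
    by (cases "x \<in> carrier G") (simp_all add: AutoGroup_simps)
qed

text \<open>A prime \<open>q \<noteq> p\<close> dividing the order would give, by Cauchy's theorem, an element of order \<open>q\<close>,
  whose \<open>p\<close>-power powers are all nontrivial.\<close>
lemma order_prime_power_if_exponents:
  assumes fin: "finite (carrier G)" and p: "Factorial_Ring.prime p"
    and exp: "\<And>x. x \<in> carrier G \<Longrightarrow> \<exists>k. x [^] (p ^ k :: nat) = \<one>"
  shows "\<exists>k. order G = p ^ k"
proof -
  have pos: "order G \<noteq> 0" using order_gt_0_iff_finite fin by auto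
  have "\<not> is_unit p" using p by auto
  then obtain a m where m: "order G = p ^ a * m" "\<not> p dvd m"
    using multiplicity_decompose'[OF pos] by blast
  have "m = 1"
  proof (rule ccontr)
    assume "m \<noteq> 1"
    then obtain q where q: "Factorial_Ring.prime q" "q dvd m" using prime_factor_nat by blast
    then have "q \<noteq> p" using m(2) by blast
    have "q dvd order G" unfolding m(1) using q(2) by (rule dvd_mult)
    then have "order G = q ^ 1 * (order G div q)" by simp
    \<comment> \<open>Sylow's existence theorem holds for every prime power dividing the order; here the power is \<open>q\<close> itself.\<close>
    from sylow_thm[OF q(1) is_group this fin]
    obtain H where H: "subgroup H G" "card H = q" unfolding power_one_right by blast
    have "H \<noteq> {\<one>}"
    proof
      assume "H = {\<one>}"
      then have "q = 1" using H(2) by simp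
      then show False using q(1) by simp
    qed
    then obtain x where x: "x \<in> H" "x \<noteq> \<one>" using subgroup.one_closed[OF H(1)] by blast
    then have xc: "x \<in> carrier G" using subgroup.mem_carrier[OF H(1)] by blast
    obtain k where "x [^] (p ^ k) = \<one>" using exp[OF xc] by blast
    moreover have "x [^] q = \<one>" using pow_card_subgroup[OF H(1) x(1)] H(2) by simp
    moreover have "coprime (p ^ k) q" using \<open>q \<noteq> p\<close> p q(1) by (simp add: primes_coprime)
    ultimately show False using pow_eq_one_coprime[OF xc] x(2) by blast
  qed
  then have "order G = p ^ a" using m(1) by simp
  then show ?thesis ..
qed

end

section \<open>Groups of prime power order with automorphism groups of prime power order\<close>

text \<open>All orbits other than fixed points have size divisible by \<open>p\<close>. If \<open>e\<close> were the only fixed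
  point, the size of \<open>E\<close> would be \<open>1\<close> modulo \<open>p\<close>.\<close>
lemma (in group_action) p_group_second_fixed_point:
  assumes p: "Factorial_Ring.prime p" and ord: "order G = p ^ k" and fin: "finite E" and dvd: "p dvd card E"
    and e: "e \<in> E" "\<And>g. g \<in> carrier G \<Longrightarrow> \<phi> g e = e"
  shows "\<exists>x\<in>E. x \<noteq> e \<and> (\<forall>g\<in>carrier G. \<phi> g x = x)"
proof (rule ccontr)
  assume none: "\<not> ?thesis"
  interpret G: group G using group_hom group_hom.axioms(1) by blast
  let ?O = "orbits G E \<phi>"
  have fO: "finite ?O" using fin by (auto simp: orbits_def)
  have oe: "orbit G \<phi> e = {e}" using orbit_refl[OF e(1)] e(2) by (auto simp: orbit_def)
  then have eO: "{e} \<in> ?O" using e(1) by (auto simp: orbits_def)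
  have "p dvd card C" if C: "C \<in> ?O - {{e}}" for C
  proof -
    obtain x where x: "x \<in> E" and Cx: "C = orbit G \<phi> x" using C by (auto simp: orbits_def)
    have "card C dvd p ^ k"
      using dvd_triv_left[of "card C"] orbit_stabilizer_theorem[OF x, folded Cx] ord by metis
    then obtain i where i: "card C = p ^ i" using divides_primepow_nat[OF p] by blast
    have "card C \<noteq> 1"
    proof
      assume "card C = 1"
      then have "C = {x}" using orbit_refl[OF x] Cx by (auto simp: card_1_singleton_iff)
      then have "\<phi> g x = x" if "g \<in> carrier G" for g
        using Cx that unfolding orbit_def by blast
      then have "x = e" using none x by blast
      then show False using C \<open>C = {x}\<close> by blast
    qed
    then have "i \<noteq> 0" using i by auto
    then show ?thesis using i by simp
  qed
  then have pS: "p dvd (\<Sum>C\<in>?O - {{e}}. card C)" by (rule dvd_sum)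
  have "card E = (\<Sum>C\<in>?O. card C)"
    using disjoint_sum[OF fin, of "\<lambda>_. 1::nat"] by (simp only: card_eq_sum)
  then have "card E = 1 + (\<Sum>C\<in>?O - {{e}}. card C)"
    using sum.remove[OF fO eO, of card] by simp
  then have "p dvd 1" using dvd dvd_add_left_iff[OF pS, of 1] by simp
  then show False using p by simp
qed

context group
begin

lemma auto_image_rcoset:
  assumes N: "subgroup N G" "\<forall>\<alpha>\<in>auto G. \<forall>x\<in>N. \<alpha> x \<in> N"
    and a: "\<alpha> \<in> auto G" and x: "x \<in> carrier G"
  shows "\<alpha> ` (N #> x) = N #> \<alpha> x"
proof -
  interpret N: subgroup N G by (rule N(1))
  obtain \<beta> where b: "\<beta> \<in> auto G" "\<And>x. x \<in> carrier G \<Longrightarrow> \<alpha> (\<beta> x) = x"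
    by (rule auto_inverse[OF a]) blast
  have sub: "\<gamma> y \<in> N" if "\<gamma> \<in> auto G" "y \<in> N" for \<gamma> y
    by (rule bspec[OF bspec[OF N(2) that(1)] that(2)])
  show ?thesis
  proof (intro equalityI subsetI)
    fix z assume "z \<in> \<alpha> ` (N #> x)"
    then obtain h where h: "h \<in> N" "z = \<alpha> (h \<otimes> x)" unfolding r_coset_def by blast
    have "z = \<alpha> h \<otimes> \<alpha> x" unfolding h(2) by (rule auto_mult[OF a N.mem_carrier[OF h(1)] x])
    then show "z \<in> N #> \<alpha> x" unfolding r_coset_def using sub[OF a h(1)] by blast
  next
    fix z assume "z \<in> N #> \<alpha> x"
    then obtain h where h: "h \<in> N" "z = h \<otimes> \<alpha> x" unfolding r_coset_def by blast
    have bh: "\<beta> h \<in> N" by (rule sub[OF b(1) h(1)])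
    have "\<alpha> (\<beta> h \<otimes> x) = z"
      unfolding h(2) auto_mult[OF a N.mem_carrier[OF bh] x] b(2)[OF N.mem_carrier[OF h(1)]] ..
    then show "z \<in> \<alpha> ` (N #> x)" unfolding r_coset_def using bh by blast
  qed
qed

lemma auto_action_on_rcosets:
  assumes N: "subgroup N G" "\<forall>\<alpha>\<in>auto G. \<forall>x\<in>N. \<alpha> x \<in> N"
  shows "group_action (AutoGroup G) (rcosets N) (\<lambda>\<alpha>. \<lambda>C\<in>rcosets N. \<alpha> ` C)"
proof -
  let ?E = "rcosets N" and ?\<phi> = "\<lambda>\<alpha>. \<lambda>C\<in>rcosets N. \<alpha> ` C"
  have cl: "\<alpha> ` C \<in> ?E" if a: "\<alpha> \<in> auto G" and "C \<in> ?E" for \<alpha> C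
  proof -
    obtain x where x: "x \<in> carrier G" "C = N #> x" using \<open>C \<in> ?E\<close> by (auto simp: RCOSETS_def)
    then show ?thesis
      using auto_image_rcoset[OF N a x(1)] rcosetsI[OF subgroup.subset[OF N(1)] auto_closed[OF a x(1)]] by simp
  qed
  have sub: "C \<subseteq> carrier G" if "C \<in> ?E" for C
    using rcosets_part_G[OF N(1)] that by blast
  have bij: "?\<phi> \<alpha> \<in> Bij ?E" if a: "\<alpha> \<in> auto G" for \<alpha>
  proof -
    obtain \<beta> where b: "\<beta> \<in> auto G" "\<And>x. x \<in> carrier G \<Longrightarrow> \<alpha> (\<beta> x) = x" "\<And>x. x \<in> carrier G \<Longrightarrow> \<beta> (\<alpha> x) = x"
      using auto_inverse[OF a] by metis
    have "bij_betw (?\<phi> \<alpha>) ?E ?E"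
    proof (rule bij_betw_byWitness[where f' = "?\<phi> \<beta>"])
      show "\<forall>C\<in>?E. ?\<phi> \<beta> (?\<phi> \<alpha> C) = C"
        using cl[OF a] sub b(3) by (force simp: image_image subset_iff image_def)
      show "\<forall>C\<in>?E. ?\<phi> \<alpha> (?\<phi> \<beta> C) = C"
        using cl[OF b(1)] sub b(2) by (force simp: image_image subset_iff image_def)
    qed (use cl a b(1) in auto)
    then show ?thesis by (simp add: Bij_def)
  qed
  have "?\<phi> \<in> hom (AutoGroup G) (BijGroup ?E)"
  proof (rule homI)
    fix \<alpha> assume "\<alpha> \<in> carrier (AutoGroup G)"
    then show "?\<phi> \<alpha> \<in> carrier (BijGroup ?E)" using bij by (simp add: AutoGroup_simps BijGroup_def)
  next
    fix \<alpha> \<beta> assume "\<alpha> \<in> carrier (AutoGroup G)" "\<beta> \<in> carrier (AutoGroup G)"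
    then have ab: "\<alpha> \<in> auto G" "\<beta> \<in> auto G" by (simp_all add: AutoGroup_simps)
    have "compose (carrier G) \<alpha> \<beta> ` C = \<alpha> ` \<beta> ` C" if "C \<in> ?E" for C
      using sub[OF that] by (auto simp: compose_def image_image subset_iff)
    then show "?\<phi> (\<alpha> \<otimes>\<^bsub>AutoGroup G\<^esub> \<beta>) = ?\<phi> \<alpha> \<otimes>\<^bsub>BijGroup ?E\<^esub> ?\<phi> \<beta>"
      using ab bij cl by (auto simp: AutoGroup_simps BijGroup_def compose_def fun_eq_iff)
  qed
  then show ?thesis
    by (simp add: group_action_def group_hom_def group_hom_axioms_def AutoGroup group_BijGroup)
qed

text \<open>A fixed point of \<open>Aut G\<close> on the cosets of \<open>L\<^sub>n\<close> is a coset \<open>C\<close> with \<open>[x, \<alpha>] \<in> L\<^sub>n\<close> for all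
  \<open>x \<in> C\<close> and all \<open>\<alpha>\<close>, that is, a coset inside \<open>L\<^sub>n\<^sub>+\<^sub>1\<close>. The coset \<open>L\<^sub>n\<close> itself is one, and the number of
  cosets is a nontrivial power of \<open>p\<close>, so there is another.\<close>
lemma autocentre_psubset_Suc:
  assumes p: "Factorial_Ring.prime p" and ord: "order G = p ^ a" and aut: "order (AutoGroup G) = p ^ k"
    and proper: "autocentre G n \<noteq> carrier G"
  shows "autocentre G n \<subset> autocentre G (Suc n)"
proof -
  let ?N = "autocentre G n"
  interpret N: normal ?N G by (rule autocentre_normal)
  have N: "subgroup ?N G" "\<forall>\<alpha>\<in>auto G. \<forall>x\<in>?N. \<alpha> x \<in> ?N"
    using autocentre_subgroup autocentre_invariant by blast+
  have fin: "finite (carrier G)" using ord p order_gt_0_iff_finite by (simp add: prime_gt_0_nat)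
  interpret act: group_action "AutoGroup G" "rcosets ?N" "\<lambda>\<alpha>. \<lambda>C\<in>rcosets ?N. \<alpha> ` C"
    by (rule auto_action_on_rcosets[OF N])
  have fE: "finite (rcosets ?N)" using fin by (auto simp: RCOSETS_def)
  have lag: "card (rcosets ?N) * card ?N = p ^ a" using lagrange[OF N(1)] ord by simp
  have "card (rcosets ?N) \<noteq> 1"
  proof
    assume "card (rcosets ?N) = 1"
    then have "card ?N = card (carrier G)" using lag ord by (simp add: order_def)
    then show False using proper card_subset_eq[OF fin N.subset] by simp
  qed
  then have pE: "p dvd card (rcosets ?N)"
    using p lag by (metis divides_primepow_nat dvd_triv_left dvd_power power_0 gr0I)
  have NE: "?N \<in> rcosets ?N" using rcosetsI[OF N.subset one_closed] by (simp add: N.subset)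
  have fixN: "(\<lambda>C\<in>rcosets ?N. \<alpha> ` C) ?N = ?N" if "\<alpha> \<in> carrier (AutoGroup G)" for \<alpha>
    using auto_image_rcoset[OF N _ one_closed, of \<alpha>] that NE
    by (simp add: AutoGroup_simps auto_one N.subset)
  obtain C where C: "C \<in> rcosets ?N" "C \<noteq> ?N"
      "\<And>\<alpha>. \<alpha> \<in> carrier (AutoGroup G) \<Longrightarrow> (\<lambda>C\<in>rcosets ?N. \<alpha> ` C) C = C"
    using act.p_group_second_fixed_point[OF p aut fE pE NE fixN] by metis
  obtain x where x: "x \<in> carrier G" "C = ?N #> x" using C(1) by (auto simp: RCOSETS_def)
  have "x \<notin> ?N" using coset_join2[OF x(1) N(1)] C(2) x(2) by blast
  moreover have "autocommutator G x \<alpha> \<in> ?N" if a: "\<alpha> \<in> auto G" for \<alpha>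
  proof -
    have "?N #> \<alpha> x = ?N #> x"
      using auto_image_rcoset[OF N a x(1)] C(1,3) x a by (simp add: AutoGroup_simps)
    then have "\<alpha> x \<otimes> inv x \<in> ?N"
      using N.rcos_module_imp[OF is_group x(1)] rcos_self[OF auto_closed[OF a x(1)] N(1)] by simp
    \<comment> \<open>Right cosets give \<open>\<alpha> x \<otimes> inv x\<close>; normality turns it into the commutator \<open>inv x \<otimes> \<alpha> x\<close>.\<close>
    then have "inv x \<otimes> (\<alpha> x \<otimes> inv x) \<otimes> x \<in> ?N" using N.inv_op_closed1[OF x(1)] by simp
    then show ?thesis using a x(1) by (simp add: autocommutator_def m_assoc auto_closed)
  qed
  ultimately show ?thesis using autocentre_mono[of n "Suc n"] x(1) by (auto simp: autocentre_Suc)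
qed

lemma p_group_autonilpotent:
  assumes "Factorial_Ring.prime p" "order G = p ^ a" "order (AutoGroup G) = p ^ k"
  obtains n where "carrier G = autocentre G n"
proof -
  have fin: "finite (carrier G)" using assms order_gt_0_iff_finite by (simp add: prime_gt_0_nat)
  have sub: "autocentre G n \<subseteq> carrier G" for n using subgroup.subset[OF autocentre_subgroup] .
  have "\<exists>n. autocentre G n = carrier G"
  proof (rule ccontr)
    assume "\<not> ?thesis"
    then have "autocentre G n \<subset> autocentre G (Suc n)" for n
      using autocentre_psubset_Suc[OF assms] by blast
    then have less: "card (autocentre G n) < card (autocentre G (Suc n))" for n
      using sub fin by (metis finite_subset psubset_card_mono)
    have "n \<le> card (autocentre G n)" for n
    proof (induction n)
      case (Suc n)
      then show ?case using less[of n] by simp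
    qed simp
    then have "Suc (card (carrier G)) \<le> card (carrier G)"
      using card_mono[OF fin sub] by (meson le_trans)
    then show False by simp
  qed
  then show ?thesis using that by metis
qed

section \<open>Passing between a group and a subgroup\<close>

text \<open>If the automorphisms of \<open>G\<close> restrict to \<open>H\<close>, there are fewer conditions to satisfy in \<open>G\<close>
  than in \<open>H\<close>.\<close>
lemma autocentre_subgroup_le:
  assumes H: "subgroup H G" and restr: "\<And>\<alpha>. \<alpha> \<in> auto G \<Longrightarrow> restrict \<alpha> H \<in> auto (G\<lparr>carrier := H\<rparr>)"
  shows "autocentre (G\<lparr>carrier := H\<rparr>) n \<subseteq> autocentre G n"
proof (induction n)
  interpret H: group "G\<lparr>carrier := H\<rparr>" using H by (rule subgroup_imp_group)
  case 0
  show ?case using H.autocentre_0 autocentre_0 by simp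
next
  interpret H: group "G\<lparr>carrier := H\<rparr>" using H by (rule subgroup_imp_group)
  case (Suc n)
  show ?case
  proof
    fix x assume x: "x \<in> autocentre (G\<lparr>carrier := H\<rparr>) (Suc n)"
    then have xH: "x \<in> H" by (simp add: H.autocentre_Suc)
    have "autocommutator G x \<alpha> \<in> autocentre G n" if a: "\<alpha> \<in> auto G" for \<alpha>
    proof -
      have "autocommutator (G\<lparr>carrier := H\<rparr>) x (restrict \<alpha> H) = autocommutator G x \<alpha>"
        using xH H by (simp add: autocommutator_def)
      then show ?thesis using x restr[OF a] Suc by (auto simp: H.autocentre_Suc)
    qed
    then show "x \<in> autocentre G (Suc n)"
      using xH H by (simp add: autocentre_Suc subgroup.mem_carrier)
  qed
qed

text \<open>If the automorphisms of \<open>H\<close> extend to \<open>G\<close>, there are fewer conditions to satisfy in \<open>H\<close> than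
  in \<open>G\<close>.\<close>
lemma autocentre_subgroup_ge:
  assumes H: "subgroup H G"
    and ext: "\<And>\<beta>. \<beta> \<in> auto (G\<lparr>carrier := H\<rparr>) \<Longrightarrow> \<exists>\<alpha>\<in>auto G. \<forall>x\<in>H. \<alpha> x = \<beta> x"
  shows "H \<inter> autocentre G n \<subseteq> autocentre (G\<lparr>carrier := H\<rparr>) n"
proof (induction n)
  interpret H: group "G\<lparr>carrier := H\<rparr>" using H by (rule subgroup_imp_group)
  case 0
  show ?case using H.autocentre_0 autocentre_0 by simp
next
  interpret H: group "G\<lparr>carrier := H\<rparr>" using H by (rule subgroup_imp_group)
  case (Suc n)
  show ?case
  proof
    fix x assume x: "x \<in> H \<inter> autocentre G (Suc n)"
    have "autocommutator (G\<lparr>carrier := H\<rparr>) x \<beta> \<in> autocentre (G\<lparr>carrier := H\<rparr>) n"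
      if b: "\<beta> \<in> auto (G\<lparr>carrier := H\<rparr>)" for \<beta>
    proof -
      obtain \<alpha> where a: "\<alpha> \<in> auto G" "\<forall>x\<in>H. \<alpha> x = \<beta> x" using ext[OF b] by blast
      have "autocommutator (G\<lparr>carrier := H\<rparr>) x \<beta> = autocommutator G x \<alpha>"
        using x H a(2) by (simp add: autocommutator_def)
      moreover have "autocommutator (G\<lparr>carrier := H\<rparr>) x \<beta> \<in> H"
        using H.autocommutator_closed[OF b] x by simp
      ultimately show ?thesis using x a(1) Suc by (auto simp: autocentre_Suc)
    qed
    then show "x \<in> autocentre (G\<lparr>carrier := H\<rparr>) (Suc n)" using x by (simp add: H.autocentre_Suc)
  qed
qed

section \<open>Sylow subgroups\<close>

lemma sylow_subgroup_exists:
  assumes "finite (carrier G)" and p: "Factorial_Ring.prime p"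
  obtains P where "P \<in> sylow_subgroups G p"
proof -
  have "order G = p ^ multiplicity p (order G) * (order G div p ^ multiplicity p (order G))"
    by (simp add: multiplicity_dvd)
  from sylow_thm[OF p is_group this assms(1)] show ?thesis
    using that by (auto simp: sylow_subgroups_def)
qed

text \<open>By Lagrange's theorem, the order of \<open>H\<close> is divisible by the full \<open>p\<close>-part of the group
  order for every \<open>p\<close>.\<close>
lemma subgroup_containing_sylows:
  assumes fin: "finite (carrier G)" and H: "subgroup H G"
    and syl: "\<And>p. p \<in> prime_factors (order G) \<Longrightarrow> \<exists>P\<in>sylow_subgroups G p. P \<subseteq> H"
  shows "H = carrier G"
proof -
  interpret H: group "G\<lparr>carrier := H\<rparr>" using H by (rule subgroup_imp_group)
  have HG: "H \<subseteq> carrier G" using H by (rule subgroup.subset)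
  have pos: "order G \<noteq> 0" "card H \<noteq> 0"
    using fin order_gt_0_iff_finite subgroup.finite_imp_card_positive[OF H fin] by simp_all
  have "order G dvd card H"
  proof (rule multiplicity_le_imp_dvd[OF pos(1)])
    fix p :: nat assume p: "Factorial_Ring.prime p"
    show "multiplicity p (order G) \<le> multiplicity p (card H)"
    proof (cases "p \<in> prime_factors (order G)")
      case True
      then obtain P where P: "P \<in> sylow_subgroups G p" "P \<subseteq> H" using syl by blast
      have "subgroup P (G\<lparr>carrier := H\<rparr>)" using subgroup_incl[OF _ H P(2)] P(1) by (simp add: sylow_subgroups_def)
      then have "p ^ multiplicity p (order G) dvd card H"
        using H.card_subgroup_dvd[of P] P(1) by (simp add: sylow_subgroups_def order_def)
      then show ?thesis using p pos(2) by (intro multiplicity_geI) auto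
    next
      case False
      then have "\<not> p dvd order G" using p pos(1) by (simp add: prime_factors_dvd)
      then show ?thesis by (simp add: not_dvd_imp_multiplicity_0)
    qed
  qed
  then have "card (carrier G) \<le> card H" using pos(2) by (simp add: order_def dvd_imp_le)
  then show ?thesis using HG fin by (simp add: card_seteq)
qed

lemma generate_sylow_subgroups:
  assumes fin: "finite (carrier G)"
  shows "generate G (\<Union>(\<Union>p\<in>prime_factors (order G). sylow_subgroups G p)) = carrier G"
    (is "generate G ?U = _")
proof (rule subgroup_containing_sylows[OF fin generate_is_subgroup])
  show "?U \<subseteq> carrier G"
    by (auto simp: sylow_subgroups_def dest: subgroup.subset)
  fix p assume p: "p \<in> prime_factors (order G)"
  then have "Factorial_Ring.prime p" by (rule in_prime_factors_imp_prime)
  then obtain P where P: "P \<in> sylow_subgroups G p"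
    using sylow_subgroup_exists[OF fin] by metis
  have "P \<subseteq> generate G ?U"
  proof
    fix x assume "x \<in> P"
    then have "x \<in> ?U" using P p by blast
    then show "x \<in> generate G ?U" by (rule generate.incl)
  qed
  then show "\<exists>P\<in>sylow_subgroups G p. P \<subseteq> generate G ?U" using P by (rule bexI)
qed

text \<open>The quotient by \<open>P\<close> has order prime to \<open>p\<close>, so an element of \<open>p\<close>-power order dies in it. This
  makes a normal Sylow subgroup unique and characteristic.\<close>
lemma normal_sylow_contains:
  assumes fin: "finite (carrier G)" and p: "Factorial_Ring.prime p"
    and P: "P \<in> sylow_subgroups G p" and "P \<lhd> G"
    and x: "x \<in> carrier G" and xk: "x [^] (p ^ k :: nat) = \<one>"
  shows "x \<in> P"
proof -
  interpret P: normal P G by fact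
  interpret Q: group "G Mod P" by (rule P.factorgroup_is_group)
  have pos: "order G \<noteq> 0" using fin order_gt_0_iff_finite by auto
  have eq: "order (G Mod P) * p ^ multiplicity p (order G) = order G"
    using lagrange[OF P.is_subgroup] P by (simp add: order_def FactGroup_def sylow_subgroups_def)
  have "\<not> p dvd order (G Mod P)"
  proof
    assume "p dvd order (G Mod P)"
    then have "p ^ Suc (multiplicity p (order G)) dvd order G"
      unfolding power_Suc by (subst (2) eq[symmetric]) (rule mult_dvd_mono, simp_all)
    then have "Suc (multiplicity p (order G)) \<le> multiplicity p (order G)"
      using pos p by (intro multiplicity_geI) auto
    then show False by simp
  qed
  then have cop: "coprime (p ^ k) (order (G Mod P))" using p by (simp add: prime_imp_coprime)
  have c: "P #> x \<in> carrier (G Mod P)" using x by (auto simp: carrier_FactGroup)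
  have "(P #> x) [^]\<^bsub>G Mod P\<^esub> (p ^ k) = \<one>\<^bsub>G Mod P\<^esub>"
    using P.FactGroup_pow[OF x] by (simp add: xk P.subset)
  then have "P #> x = \<one>\<^bsub>G Mod P\<^esub>"
    using Q.pow_eq_one_coprime[OF c _ Q.pow_order_eq_1[OF c] cop] by blast
  then show ?thesis using coset_join1[OF _ x P.is_subgroup] by simp
qed

lemma normal_sylow_unique:
  assumes fin: "finite (carrier G)" and p: "Factorial_Ring.prime p"
    and P: "P \<in> sylow_subgroups G p" "P \<lhd> G" and Q: "Q \<in> sylow_subgroups G p"
  shows "Q = P"
proof (rule card_subset_eq)
  have sub: "subgroup P G" "subgroup Q G" using P(1) Q by (auto simp: sylow_subgroups_def)
  show "finite P" using subgroup.subset[OF sub(1)] fin by (rule finite_subset)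
  show "card Q = card P" using P(1) Q by (simp add: sylow_subgroups_def)
  show "Q \<subseteq> P"
  proof
    fix x assume x: "x \<in> Q"
    have "x [^] (p ^ multiplicity p (order G)) = \<one>"
      using pow_card_subgroup[OF sub(2) x] Q by (simp add: sylow_subgroups_def)
    then show "x \<in> P"
      using normal_sylow_contains[OF fin p P subgroup.mem_carrier[OF sub(2) x]] by blast
  qed
qed

lemma auto_nat_pow: "\<alpha> \<in> auto G \<Longrightarrow> x \<in> carrier G \<Longrightarrow> \<alpha> (x [^] (n::nat)) = \<alpha> x [^] n"
  by (rule group_hom.hom_nat_pow[OF auto_group_hom])

lemma normal_sylow_restrict_auto:
  assumes fin: "finite (carrier G)" and p: "Factorial_Ring.prime p"
    and P: "P \<in> sylow_subgroups G p" "P \<lhd> G" and a: "\<alpha> \<in> auto G"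
  shows "restrict \<alpha> P \<in> auto (G\<lparr>carrier := P\<rparr>)"
proof -
  have sub: "subgroup P G" and PG: "P \<subseteq> carrier G"
    using P(1) by (auto simp: sylow_subgroups_def subgroup.subset)
  have maps: "\<alpha> x \<in> P" if x: "x \<in> P" for x
  proof -
    have xc: "x \<in> carrier G" using x PG by blast
    have "x [^] (p ^ multiplicity p (order G)) = \<one>"
      using pow_card_subgroup[OF sub x] P(1) by (simp add: sylow_subgroups_def)
    then have "\<alpha> x [^] (p ^ multiplicity p (order G)) = \<one>"
      using auto_nat_pow[OF a xc, of "p ^ multiplicity p (order G)"] auto_one[OF a] by simp
    then show ?thesis using normal_sylow_contains[OF fin p P auto_closed[OF a xc]] by blast
  qed
  have "inj_on \<alpha> (carrier G)" using a by (auto simp: auto_def Bij_def bij_betw_def)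
  then have inj: "inj_on \<alpha> P" using PG by (rule inj_on_subset)
  have fP: "finite P" using PG fin by (rule finite_subset)
  have "\<alpha> ` P = P" using maps by (intro endo_inj_surj fP inj) blast
  then have "bij_betw (restrict \<alpha> P) P P" using inj by (simp add: bij_betw_def inj_on_def)
  moreover have "restrict \<alpha> P \<in> hom (G\<lparr>carrier := P\<rparr>) (G\<lparr>carrier := P\<rparr>)"
  proof (rule homI)
    fix x y assume "x \<in> carrier (G\<lparr>carrier := P\<rparr>)" "y \<in> carrier (G\<lparr>carrier := P\<rparr>)"
    then show "restrict \<alpha> P (x \<otimes>\<^bsub>G\<lparr>carrier := P\<rparr>\<^esub> y) =
        restrict \<alpha> P x \<otimes>\<^bsub>G\<lparr>carrier := P\<rparr>\<^esub> restrict \<alpha> P y"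
      using auto_mult[OF a, of x y] PG subgroup.m_closed[OF sub, of x y] by (simp add: subset_iff)
  qed (simp add: maps)
  ultimately show ?thesis by (simp add: auto_def Bij_def)
qed

text \<open>An exponent bound that serves as a substitute for computing the order of a product of normal
  subgroups: it suffices to know which primes can divide orders of elements. For the
  induction, \<open>x = a u\<close> with \<open>a \<in> A\<close> agrees with \<open>u\<close> modulo \<open>A\<close>, so a power that kills \<open>u\<close> moves \<open>x\<close> into \<open>A\<close>.\<close>
lemma generate_normals_pow:
  assumes "finite \<F>" and "\<And>A. A \<in> \<F> \<Longrightarrow> A \<lhd> G" and "x \<in> generate G (\<Union>\<F>)"
  shows "x [^] (\<Prod>A\<in>\<F>. card A) = \<one>"
  using assms
proof (induction \<F> arbitrary: x rule: finite_induct)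
  case empty
  then show ?case by (simp add: generate_empty)
next
  case (insert A \<F>)
  interpret A: normal A G using insert.prems by blast
  have UF: "\<Union>\<F> \<subseteq> carrier G"
    using insert.prems(1)[THEN normal_imp_subgroup, THEN subgroup.subset] by auto
  interpret AF: second_isomorphism_grp A G "generate G (\<Union>\<F>)"
    by (simp add: second_isomorphism_grp_def second_isomorphism_grp_axioms_def
        A.normal_axioms generate_is_subgroup[OF UF])
  have "\<Union>\<F> \<subseteq> generate G (\<Union>\<F>)" by (intro subsetI generate.incl)
  then have "\<Union>(insert A \<F>) \<subseteq> A <#> generate G (\<Union>\<F>)"
    unfolding Union_insert
    by (intro Un_least AF.H_contained_in_set_mult subset_trans[OF _ AF.S_contained_in_set_mult])
  from subsetD[OF generate_subgroup_incl[OF this AF.normal_set_mult_subgroup] insert.prems(2)]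
  have "x \<in> A <#> generate G (\<Union>\<F>)" .
  then obtain a u where a: "a \<in> A" and u: "u \<in> generate G (\<Union>\<F>)" and x: "x = a \<otimes> u"
    by (auto simp: set_mult_def)
  let ?k = "\<Prod>A\<in>\<F>. card A"
  have uc: "u \<in> carrier G" using generate_in_carrier[OF UF u] .
  have uk: "u [^] ?k = \<one>" using insert.IH[OF _ u] insert.prems(1) by simp
  have ac: "a \<in> carrier G" using a by (rule A.mem_carrier)
  have xc: "x \<in> carrier G" using ac uc x by simp
  have "A #> x = A #> u"
    using coset_mult_assoc[OF A.subset ac uc] coset_join2[OF ac A.is_subgroup a] x by simp
  then have "A #> (x [^] ?k) = A"
    using A.FactGroup_pow[OF xc, of ?k] A.FactGroup_pow[OF uc, of ?k] by (simp add: uk A.subset)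
  then have "x [^] ?k \<in> A" using coset_join1[OF _ _ A.is_subgroup] xc by simp
  then have "(x [^] ?k) [^] card A = \<one>" by (rule pow_card_subgroup[OF A.is_subgroup])
  then show ?case using insert.hyps xc by (simp add: nat_pow_pow mult.commute)
qed

text \<open>The extension acts as the identity on the complementary factor: it is \<open>\<beta> \<times> id\<close> transported
  along the isomorphism \<open>A \<times> B \<cong> G\<close>.\<close>
lemma direct_factor_auto_extend:
  assumes A: "A \<lhd> G" and B: "B \<lhd> G" and AB: "A \<inter> B \<subseteq> {\<one>}" "A <#> B = carrier G"
    and b: "\<beta> \<in> auto (G\<lparr>carrier := A\<rparr>)"
  shows "\<exists>\<alpha>\<in>auto G. \<forall>x\<in>A. \<alpha> x = \<beta> x"
proof -
  interpret A: normal A G by fact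
  interpret B: normal B G by fact
  interpret D: group_disjoint_sum G A B by unfold_locales
  let ?GA = "G\<lparr>carrier := A\<rparr>" and ?GB = "G\<lparr>carrier := B\<rparr>"
  have sg: "subgroup_generated G A = ?GA" "subgroup_generated G B = ?GB"
    using A.carrier_subgroup_generated_subgroup B.carrier_subgroup_generated_subgroup
    by (simp_all add: subgroup_generated_def)
  define f where "f = (\<lambda>(x :: 'a, y). x \<otimes> y)"
  have f: "f \<in> iso (?GA \<times>\<times> ?GB) G"
    using iso_group_mul_gen[OF A B] AB sg by (simp add: f_def)
  interpret GA: group ?GA by (rule subgroup_imp_group[OF A.is_subgroup])
  interpret GB: group ?GB by (rule subgroup_imp_group[OF B.is_subgroup])
  interpret AxB: group "?GA \<times>\<times> ?GB" by (rule DirProd_group[OF GA.is_group GB.is_group])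
  define h where "h = (\<lambda>(x, y :: 'a). (\<beta> x, id y))"
  have "\<beta> \<in> iso ?GA ?GA" using b by (auto simp: auto_def iso_def Bij_def)
  then have h: "h \<in> iso (?GA \<times>\<times> ?GB) (?GA \<times>\<times> ?GB)"
    unfolding h_def iso_paired2[OF GA.is_group GB.is_group] using id_iso by blast
  define g where "g = inv_into (carrier (?GA \<times>\<times> ?GB)) f"
  have g: "g \<in> iso G (?GA \<times>\<times> ?GB)" using AxB.iso_set_sym[OF f] by (simp add: g_def)
  have fhg: "f \<circ> h \<circ> g \<in> iso G G"
    using iso_set_trans[OF g iso_set_trans[OF h f]] by (simp add: comp_assoc)
  have "restrict (f \<circ> h \<circ> g) (carrier G) \<in> auto G"
    using fhg by (auto simp: auto_def iso_def Bij_def hom_def)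
  moreover have "restrict (f \<circ> h \<circ> g) (carrier G) x = \<beta> x" if x: "x \<in> A" for x
  proof -
    have inj: "inj_on f (carrier (?GA \<times>\<times> ?GB))" using f by (auto simp: iso_def bij_betw_def)
    have "f (x, \<one>) = x" using A.mem_carrier[OF x] by (simp add: f_def)
    moreover have "(x, \<one>) \<in> carrier (?GA \<times>\<times> ?GB)" using x by simp
    ultimately have gx: "g x = (x, \<one>)" unfolding g_def using inv_into_f_f[OF inj] by metis
    have "\<beta> x \<in> A" using GA.auto_closed[OF b] x by simp
    then show ?thesis using A.mem_carrier[OF x] A.mem_carrier by (simp add: gx h_def f_def)
  qed
  ultimately show ?thesis by blast
qed

section \<open>Sylow subgroups of autonilpotent groups\<close>

text \<open>The normaliser of \<open>P\<close> contains \<open>P\<close> and, by commutation of elements of coprime order, every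
  Sylow subgroup for a prime other than \<open>p\<close>. Hence it is the whole group.\<close>
lemma autonilpotent_sylow_normal:
  assumes fin: "finite (carrier G)" and nil: "autonilpotent G" and p: "Factorial_Ring.prime p"
    and P: "P \<in> sylow_subgroups G p"
  shows "P \<lhd> G"
proof -
  have sub: "subgroup P G" using P by (simp add: sylow_subgroups_def)
  have PG: "P \<subseteq> carrier G" using sub by (rule subgroup.subset)
  have "normalizer G P = carrier G"
  proof (rule subgroup_containing_sylows[OF fin normalizer_imp_subgroup[OF PG]])
    have mem: "g \<in> normalizer G P" if g: "g \<in> carrier G" and "(g <# P) = (P #> g)" for g
    proof -
      have "(g <# P) #> inv g = P" using that PG by (simp add: coset_mult_assoc)
      then show ?thesis using g PG by (simp add: normalizer_def stabilizer_def)
    qed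
    fix q assume q: "q \<in> prime_factors (order G)"
    then have qp: "Factorial_Ring.prime q" by blast
    show "\<exists>Q\<in>sylow_subgroups G q. Q \<subseteq> normalizer G P"
    proof (cases "q = p")
      case True
      have "P \<subseteq> normalizer G P"
      proof
        fix g assume "g \<in> P"
        then show "g \<in> normalizer G P"
          using coset_join2[of g P] coset_join3[of g P] sub PG by (intro mem) auto
      qed
      then show ?thesis using True P by blast
    next
      case False
      obtain Q where Q: "Q \<in> sylow_subgroups G q" using sylow_subgroup_exists[OF fin qp] .
      then have subQ: "subgroup Q G" by (simp add: sylow_subgroups_def)
      have "Q \<subseteq> normalizer G P"
      proof
        fix g assume g: "g \<in> Q"
        have gc: "g \<in> carrier G" using subgroup.mem_carrier[OF subQ g] .
        have "g \<otimes> h = h \<otimes> g" if h: "h \<in> P" for h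
        proof (rule autonilpotent_coprime_commute[OF nil gc])
          show "h \<in> carrier G" using h PG by blast
          show "g [^] card Q = \<one>" "h [^] card P = \<one>"
            using pow_card_subgroup[OF subQ g] pow_card_subgroup[OF sub h] by auto
          show "coprime (card Q) (card P)"
            using P Q p qp False by (simp add: sylow_subgroups_def primes_coprime)
        qed
        then have "(g <# P) = (P #> g)" by (auto simp: l_coset_def r_coset_def)
        then show "g \<in> normalizer G P" using mem gc by blast
      qed
      then show ?thesis using Q by blast
    qed
  qed
  then show ?thesis using subgroup_in_normalizer[OF sub] by simp
qed

lemma is_p_group_auto_of_autonilpotent:
  assumes "finite (carrier G)" "Factorial_Ring.prime p" "order G = p ^ a" "autonilpotent G"
  shows "is_p_group p (AutoGroup G)"
proof -
  interpret A: group "AutoGroup G" by (rule AutoGroup)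
  obtain n where n: "carrier G = autocentre G n" using assms(4) by (auto simp: autonilpotent_def)
  have "\<exists>k. order (AutoGroup G) = p ^ k"
  proof (rule A.order_prime_power_if_exponents[OF _ assms(2)])
    show "finite (carrier (AutoGroup G))" using finite_auto[OF assms(1)] by (simp add: AutoGroup_simps)
    fix \<alpha> assume "\<alpha> \<in> carrier (AutoGroup G)"
    then have "\<alpha> [^]\<^bsub>AutoGroup G\<^esub> (p ^ (a * n)) = \<one>\<^bsub>AutoGroup G\<^esub>"
      using autonilpotent_auto_exponent[OF n, of \<alpha>] assms(3)
      by (simp add: AutoGroup_simps(1) power_mult)
    then show "\<exists>k. \<alpha> [^]\<^bsub>AutoGroup G\<^esub> (p ^ k) = \<one>\<^bsub>AutoGroup G\<^esub>" by blast
  qed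
  then show ?thesis by (simp add: is_p_group_def A.is_group)
qed

text \<open>The other Sylow subgroups belong to primes other than \<open>p\<close>, because the normal subgroup \<open>P\<close> is the only
  Sylow \<open>p\<close>-subgroup. So by \<open>generate_normals_pow\<close> they generate a subgroup of elements of order
  prime to \<open>p\<close>, which meets \<open>P\<close> trivially.\<close>
lemma autonilpotent_sylow_complement:
  assumes fin: "finite (carrier G)" and nil: "autonilpotent G"
    and p: "p \<in> prime_factors (order G)" and P: "P \<in> sylow_subgroups G p"
  defines "K \<equiv> generate G (\<Union>((\<Union>p\<in>prime_factors (order G). sylow_subgroups G p) - {P}))"
  shows "K \<lhd> G" "P \<inter> K = {\<one>}" "P <#> K = carrier G"
proof -
  let ?S = "\<Union>p\<in>prime_factors (order G). sylow_subgroups G p"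
  have normal: "S \<lhd> G" if "S \<in> ?S" for S
    using that autonilpotent_sylow_normal[OF fin nil in_prime_factors_imp_prime] by blast
  have PS: "P \<in> ?S" using p P by blast
  then interpret P: normal P G by (rule normal)
  have "S \<subseteq> carrier G" if "S \<in> ?S" for S
    using normal_imp_subgroup[OF normal[OF that]] by (rule subgroup.subset)
  then have U: "\<Union>?S \<subseteq> carrier G" "\<Union>(?S - {P}) \<subseteq> carrier G" by blast+
  show K: "K \<lhd> G"
    unfolding K_def
  proof (rule normal_generateI[OF U(2)])
    fix h g assume "h \<in> \<Union>(?S - {P})" and g: "g \<in> carrier G"
    then obtain S where S: "S \<in> ?S - {P}" "h \<in> S" by blast
    then have "g \<otimes> h \<otimes> inv g \<in> S" using normal.inv_op_closed2[OF normal g] by simp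
    then show "g \<otimes> h \<otimes> inv g \<in> \<Union>(?S - {P})" using S(1) by (rule UnionI[rotated])
  qed
  have subK: "subgroup K G" using K by (rule normal_imp_subgroup)
  have "?S \<subseteq> Pow (carrier G)" using U(1) by blast
  then have finS: "finite (?S - {P})" using fin by (simp add: finite_subset)
  have "z = \<one>" if zP: "z \<in> P" and zK: "z \<in> K" for z
  proof (rule pow_eq_one_coprime[OF P.mem_carrier[OF zP]])
    show "z [^] card P = \<one>" using zP by (rule pow_card_subgroup[OF P.is_subgroup])
    show "z [^] (\<Prod>S\<in>?S - {P}. card S) = \<one>"
      using generate_normals_pow[OF finS _ zK[unfolded K_def]] normal by blast
    show "coprime (card P) (\<Prod>S\<in>?S - {P}. card S)"
    proof (rule prod_coprime_right)
      fix S assume S: "S \<in> ?S - {P}"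
      then obtain q where q: "q \<in> prime_factors (order G)" "S \<in> sylow_subgroups G q" by blast
      have "q \<noteq> p"
        using normal_sylow_unique[OF fin in_prime_factors_imp_prime[OF p] P P.normal_axioms, of S] q(2) S
        by auto
      then show "coprime (card P) (card S)"
        using q P in_prime_factors_imp_prime[OF p] in_prime_factors_imp_prime[OF q(1)]
        by (simp add: sylow_subgroups_def primes_coprime)
    qed
  qed
  then show "P \<inter> K = {\<one>}" using P.one_closed subgroup.one_closed[OF subK] by blast
  interpret PK: second_isomorphism_grp P G K
    by (simp add: second_isomorphism_grp_def second_isomorphism_grp_axioms_def P.normal_axioms subK)
  have "\<Union>?S \<subseteq> P <#> K"
  proof
    fix x assume "x \<in> \<Union>?S"
    then consider "x \<in> P" | "x \<in> \<Union>(?S - {P})" by blast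
    then show "x \<in> P <#> K"
    proof cases
      case 1 then show ?thesis by (rule subsetD[OF PK.H_contained_in_set_mult])
    next
      case 2
      then have "x \<in> K" unfolding K_def by (rule generate.incl)
      then show ?thesis by (rule subsetD[OF PK.S_contained_in_set_mult])
    qed
  qed
  from generate_subgroup_incl[OF this PK.normal_set_mult_subgroup]
  show "P <#> K = carrier G"
    unfolding generate_sylow_subgroups[OF fin] using subgroup.subset[OF PK.normal_set_mult_subgroup] by simp
qed

lemma autonilpotent_sylow_autonilpotent:
  assumes fin: "finite (carrier G)" and nil: "autonilpotent G"
    and p: "p \<in> prime_factors (order G)" and P: "P \<in> sylow_subgroups G p"
  shows "autonilpotent (G\<lparr>carrier := P\<rparr>)"
proof -
  have sub: "subgroup P G" using P by (simp add: sylow_subgroups_def)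
  then interpret P: group "G\<lparr>carrier := P\<rparr>" by (rule subgroup_imp_group)
  have nP: "P \<lhd> G" using autonilpotent_sylow_normal[OF fin nil in_prime_factors_imp_prime[OF p] P] .
  note K = autonilpotent_sylow_complement[OF fin nil p P]
  have ext: "\<exists>\<alpha>\<in>auto G. \<forall>x\<in>P. \<alpha> x = \<beta> x" if "\<beta> \<in> auto (G\<lparr>carrier := P\<rparr>)" for \<beta>
    by (rule direct_factor_auto_extend[OF nP K(1) equalityD1[OF K(2)] K(3) that])
  obtain n where n: "carrier G = autocentre G n" using nil by (auto simp: autonilpotent_def)
  have "P \<inter> autocentre G n \<subseteq> autocentre (G\<lparr>carrier := P\<rparr>) n"
    by (rule autocentre_subgroup_ge[OF sub ext])
  then have "P \<subseteq> autocentre (G\<lparr>carrier := P\<rparr>) n"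
    using subgroup.subset[OF sub] n by blast
  then show ?thesis by (intro P.autonilpotentI[of n]) simp
qed

section \<open>The characterisation of autonilpotent groups\<close>

lemma normal_sylow_le_autocentre:
  assumes fin: "finite (carrier G)" and p: "Factorial_Ring.prime p"
    and P: "P \<in> sylow_subgroups G p" "P \<lhd> G"
    and aut: "is_p_group p (AutoGroup (G\<lparr>carrier := P\<rparr>))"
  shows "\<exists>n. P \<subseteq> autocentre G n"
proof -
  have sub: "subgroup P G" using P(1) by (simp add: sylow_subgroups_def)
  then interpret P: group "G\<lparr>carrier := P\<rparr>" by (rule subgroup_imp_group)
  have ord: "order (G\<lparr>carrier := P\<rparr>) = p ^ multiplicity p (order G)"
    using P(1) by (simp add: sylow_subgroups_def order_def)
  obtain k where k: "order (AutoGroup (G\<lparr>carrier := P\<rparr>)) = p ^ k"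
    using aut by (auto simp: is_p_group_def)
  obtain n where "carrier (G\<lparr>carrier := P\<rparr>) = autocentre (G\<lparr>carrier := P\<rparr>) n"
    by (rule P.p_group_autonilpotent[OF p ord k])
  moreover have "autocentre (G\<lparr>carrier := P\<rparr>) n \<subseteq> autocentre G n"
    by (rule autocentre_subgroup_le[OF sub normal_sylow_restrict_auto[OF fin p P]])
  ultimately show ?thesis by auto
qed

end

theorem theorem1p2:
  fixes G :: "('a, 'b) monoid_scheme"
  assumes "group G" and "finite (carrier G)"
  shows "autonilpotent G \<longleftrightarrow>
    internal_direct_product G (\<Union>p\<in>prime_factors (order G). sylow_subgroups G p) \<and>
    (\<forall>p\<in>prime_factors (order G). \<forall>P\<in>sylow_subgroups G p.
      is_p_group p (AutoGroup (G\<lparr>carrier := P\<rparr>)))"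
    (is "_ \<longleftrightarrow> internal_direct_product G ?S \<and> ?auts")
proof
  interpret group G by fact
  note fin = assms(2)
  assume nil: "autonilpotent G"
  have "internal_direct_product G ?S"
    unfolding internal_direct_product_def
  proof (intro conjI ballI)
    fix P assume "P \<in> ?S"
    then obtain p where p: "p \<in> prime_factors (order G)" "P \<in> sylow_subgroups G p" by blast
    show "P \<lhd> G" using autonilpotent_sylow_normal[OF fin nil in_prime_factors_imp_prime[OF p(1)] p(2)] .
    show "P \<inter> generate G (\<Union>(?S - {P})) = {\<one>\<^bsub>G\<^esub>}"
      by (rule autonilpotent_sylow_complement(2)[OF fin nil p])
  qed (rule generate_sylow_subgroups[OF fin])
  moreover have "is_p_group p (AutoGroup (G\<lparr>carrier := P\<rparr>))"
    if p: "p \<in> prime_factors (order G)" and P: "P \<in> sylow_subgroups G p" for p P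
  proof -
    have sub: "subgroup P G" using P by (simp add: sylow_subgroups_def)
    then interpret P: group "G\<lparr>carrier := P\<rparr>" by (rule subgroup_imp_group)
    show ?thesis
    proof (rule P.is_p_group_auto_of_autonilpotent)
      show "finite (carrier (G\<lparr>carrier := P\<rparr>))"
        using finite_subset[OF subgroup.subset[OF sub] fin] by simp
      show "Factorial_Ring.prime p" using p by (rule in_prime_factors_imp_prime)
      show "order (G\<lparr>carrier := P\<rparr>) = p ^ multiplicity p (order G)"
        using P by (simp add: sylow_subgroups_def order_def)
      show "autonilpotent (G\<lparr>carrier := P\<rparr>)"
        by (rule autonilpotent_sylow_autonilpotent[OF fin nil p P])
    qed
  qed
  ultimately show "internal_direct_product G ?S \<and> ?auts" by blast
next
  interpret group G by fact
  note fin = assms(2)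
  assume R: "internal_direct_product G ?S \<and> ?auts"
  have "\<exists>n. P \<subseteq> autocentre G n" if PS: "P \<in> ?S" for P
  proof -
    obtain p where p: "p \<in> prime_factors (order G)" and P: "P \<in> sylow_subgroups G p"
      using PS by blast
    have "P \<lhd> G" using R PS unfolding internal_direct_product_def by blast
    moreover have "is_p_group p (AutoGroup (G\<lparr>carrier := P\<rparr>))" using R p P by blast
    ultimately show ?thesis
      by (rule normal_sylow_le_autocentre[OF fin in_prime_factors_imp_prime[OF p] P])
  qed
  then obtain f where f: "\<And>P. P \<in> ?S \<Longrightarrow> P \<subseteq> autocentre G (f P)" by metis
  have "?S \<subseteq> Pow (carrier G)" by (auto simp: sylow_subgroups_def dest: subgroup.subset)
  then have finS: "finite ?S" using fin by (simp add: finite_subset)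
  \<comment> \<open>Any common upper bound of the \<open>f P\<close> would do, as the series is increasing.\<close>
  define m where "m = (\<Sum>P\<in>?S. f P)"
  have "P \<subseteq> autocentre G m" if P: "P \<in> ?S" for P
  proof -
    have "f P \<le> m" unfolding m_def by (rule member_le_sum[OF P _ finS]) simp
    from f[OF P] autocentre_mono[OF this] show ?thesis by (rule subset_trans)
  qed
  then have "\<Union>?S \<subseteq> autocentre G m" by (rule Union_least)
  from generate_subgroup_incl[OF this autocentre_subgroup]
  have "carrier G \<subseteq> autocentre G m" unfolding generate_sylow_subgroups[OF fin] .
  then show "autonilpotent G" by (rule autonilpotentI)
qed

end
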